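(* Let $\alpha\in\mathbb{C}$. Then $\mathcal{M}(\alpha)$ does not have any isolated points (with respect to the usual topology of $\mathbb{C}$).
   Context: For $c\in\mathbb{C}$ let $f_c(x)=x^2+c$, and let $f_c^n$ denote the $n$-fold composition of $f_c$ with itself. For $\alpha\in\mathbb{C}$, the generalized Mandelbrot set is $\mathcal{M}(\alpha)=\{c\in\mathbb{C} : \sup_{n\in\mathbb{N}}|f_c^n(\alpha)|<+\infty\}$ (equivalently, the set of $c\in\mathbb{C}$ such that $|f_c^n(\alpha)|\not\to\infty$ as $n\to\infty$). *)

theory Defs
  imports "HOL-Analysis.Analysis"
begin

definition quad_map :: "complex \<Rightarrow> complex \<Rightarrow> complex" where
  "quad_map c x = x\<^sup>2 + c"

(* The supremum of the orbit moduli is finite iff they are bounded above; the real-valued SUP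
   is unspecified on unbounded families, so finiteness is stated as boundedness. *)
definition gen_mandelbrot :: "complex \<Rightarrow> complex set" where
  "gen_mandelbrot \<alpha> = {c. bdd_above (range (\<lambda>n::nat. cmod ((quad_map c ^^ n) \<alpha>)))}"

end

(* Near an isolated point c of the set the parameters on a small circle all escape, and by
   compactness they do so uniformly.  Writing F n for the n-th iterate at \<alpha>, as a function of the
   parameter, the modulus of F (n+1) + F n is for large n bigger on the circle than at c, so this
   function has a zero inside.  At such a zero F (n+2) = F (n+1), so the parameter has a bounded
   orbit and must be c itself.  Two consecutive values of n give F (n+1) c = F n c = 0,
   whence c = 0 and \<alpha> = 0; but 0 is an interior point of the classical Mandelbrot set. *)
theory Submission
  imports Defs "HOL-Complex_Analysis.Conformal_Mappings"
begin

lemma mem_gen_mandelbrot_iff: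
  "c \<in> gen_mandelbrot \<alpha> \<longleftrightarrow> (\<exists>K. \<forall>n. cmod ((quad_map c ^^ n) \<alpha>) \<le> K)"
  by (auto simp: gen_mandelbrot_def bdd_above_def)

text \<open>The square contributes at least \<open>3 * cmod z\<close>, and subtracting
  \<open>cmod c \<le> cmod z\<close> leaves a factor 2. This factor is what keeps the sum of two
  consecutive iterates large.\<close>

lemma norm_quad_map_ge:
  assumes "3 + cmod c \<le> cmod z"
  shows "2 * cmod z \<le> cmod (quad_map c z)"
proof -
  have "3 * cmod z \<le> cmod z * cmod z"
    using assms norm_ge_zero[of c] by (intro mult_right_mono) linarith+
  moreover have "cmod z * cmod z - cmod c \<le> cmod (quad_map c z)"
    using norm_triangle_ineq4[of "z\<^sup>2 + c" c]
    by (simp add: quad_map_def norm_power power2_eq_square norm_mult)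
  ultimately show ?thesis using assms by linarith
qed

lemma norm_quad_map_add_ge:
  assumes "3 + cmod c \<le> cmod z"
  shows "cmod z \<le> cmod (quad_map c z + z)"
  using norm_quad_map_ge[OF assms] norm_triangle_ineq4[of "quad_map c z + z" z] by simp

text \<open>Beyond radius \<open>R\<close> each step at least doubles the modulus, so the orbit
  never comes back.\<close>

lemma quad_map_iterate_escape_mono:
  assumes "3 + cmod c \<le> R" "R < cmod ((quad_map c ^^ m) \<alpha>)" "m \<le> n"
  shows "R < cmod ((quad_map c ^^ n) \<alpha>)"
  using assms(3)
proof (induction n rule: dec_induct)
  case base
  show ?case by (rule assms(2))
next
  case (step n)
  then show ?case
    using norm_quad_map_ge[of c "(quad_map c ^^ n) \<alpha>"] assms(1) norm_ge_zero[of c]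
    unfolding funpow.simps comp_def by linarith
qed

lemma holomorphic_quad_map_iterate:
  "(\<lambda>c. (quad_map c ^^ n) \<alpha>) holomorphic_on S"
  by (induction n) (auto simp: quad_map_def intro!: holomorphic_intros)

text \<open>The parameters beyond \<open>R\<close> at time \<open>n\<close> form an open set, and
  these sets cover \<open>S\<close>. The largest time in a finite subcover works for all of
  \<open>S\<close>, since escaped orbits stay outside.\<close>

lemma uniform_escape:
  assumes "compact S" "S \<inter> gen_mandelbrot \<alpha> = {}" "\<And>c. c \<in> S \<Longrightarrow> 3 + cmod c \<le> R"
  obtains N where "\<And>c n. c \<in> S \<Longrightarrow> N \<le> n \<Longrightarrow> R < cmod ((quad_map c ^^ n) \<alpha>)"
proof -
  have "open {c. R < cmod ((quad_map c ^^ n) \<alpha>)}" for n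
    by (intro open_Collect_less continuous_intros
          holomorphic_on_imp_continuous_on[OF holomorphic_quad_map_iterate])
  moreover have "S \<subseteq> (\<Union>n\<in>UNIV. {c. R < cmod ((quad_map c ^^ n) \<alpha>)})"
    using assms(2) by (auto simp: mem_gen_mandelbrot_iff not_le set_eq_iff)
  ultimately obtain I :: "nat set"
    where I: "finite I" "S \<subseteq> (\<Union>n\<in>I. {c. R < cmod ((quad_map c ^^ n) \<alpha>)})"
    by (rule compactE_image[OF assms(1)]) auto
  show thesis
  proof (rule that)
    fix c n assume c: "c \<in> S" and n: "Max (insert 0 I) \<le> n"
    obtain m where m: "m \<in> I" "R < cmod ((quad_map c ^^ m) \<alpha>)"
      using I(2) c by auto
    have "m \<le> n" using n I(1) m(1) by auto
    then show "R < cmod ((quad_map c ^^ n) \<alpha>)"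
      using quad_map_iterate_escape_mono assms(3)[OF c] m(2) by blast
  qed
qed

lemma mem_gen_mandelbrot_if_eventually_fixed:
  assumes "(quad_map c ^^ Suc n) \<alpha> = (quad_map c ^^ n) \<alpha>"
  shows "c \<in> gen_mandelbrot \<alpha>"
proof -
  have fixed: "(quad_map c ^^ m) \<alpha> = (quad_map c ^^ n) \<alpha>" if "n \<le> m" for m
    using that by (induction m rule: dec_induct) (use assms in auto)
  \<comment> \<open>The orbit has only finitely many values; the sum of their moduli is a convenient
    upper bound for the maximum.\<close>
  have "cmod ((quad_map c ^^ m) \<alpha>) \<le> (\<Sum>k\<le>n. cmod ((quad_map c ^^ k) \<alpha>))" for m
  proof (cases "m \<le> n")
    case True
    then show ?thesis by (intro member_le_sum) auto
  next
    case False
    then have "cmod ((quad_map c ^^ m) \<alpha>) = cmod ((quad_map c ^^ n) \<alpha>)"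
      using fixed[of m] by simp
    also have "\<dots> \<le> (\<Sum>k\<le>n. cmod ((quad_map c ^^ k) \<alpha>))"
      by (intro member_le_sum) auto
    finally show ?thesis .
  qed
  then show ?thesis unfolding mem_gen_mandelbrot_iff by blast
qed

lemma quad_map_iterates_opposite_near:
  assumes c: "c \<in> gen_mandelbrot \<alpha>" and "0 < r"
    and sphere: "sphere c r \<inter> gen_mandelbrot \<alpha> = {}"
  obtains N where "\<And>n. N \<le> n \<Longrightarrow>
    \<exists>d\<in>ball c r. (quad_map d ^^ Suc n) \<alpha> = - (quad_map d ^^ n) \<alpha>"
proof -
  obtain K where K: "cmod ((quad_map c ^^ n) \<alpha>) \<le> K" for n
    using c by (auto simp: mem_gen_mandelbrot_iff)
  have "0 \<le> K" using K[of 0] norm_ge_zero order_trans by blast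
  \<comment> \<open>On the circle \<open>cmod d \<le> cmod c + r\<close>, so the first three terms
    give the escape radius there; \<open>2 * K\<close> bounds the sum of two iterates at the
    centre.\<close>
  define R where "R = 3 + cmod c + r + 2 * K"
  have R: "3 + cmod d \<le> R" if "d \<in> sphere c r" for d
    using that norm_triangle_ineq2[of d c] \<open>0 \<le> K\<close>
    by (simp add: R_def dist_norm norm_minus_commute)
  obtain N where N: "\<And>d n. d \<in> sphere c r \<Longrightarrow> N \<le> n \<Longrightarrow> R < cmod ((quad_map d ^^ n) \<alpha>)"
    using uniform_escape[OF compact_sphere sphere R] by blast
  show thesis
  proof (rule that)
    fix n assume n: "N \<le> n"
    define g where "g d = (quad_map d ^^ Suc n) \<alpha> + (quad_map d ^^ n) \<alpha>" for d
    have hol: "g holomorphic_on S" for S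
      unfolding g_def by (intro holomorphic_intros holomorphic_quad_map_iterate)
    have "cmod (g c) < cmod (g d)" if "cmod (c - d) = r" for d
    proof -
      have d: "d \<in> sphere c r" using that by (simp add: dist_norm)
      have "cmod (g c) \<le> 2 * K"
        unfolding g_def using norm_triangle_le[OF add_mono[OF K[of "Suc n"] K[of n]]] by simp
      also have "\<dots> < R" using \<open>0 < r\<close> norm_ge_zero[of c] unfolding R_def by linarith
      also have "R < cmod ((quad_map d ^^ n) \<alpha>)" by (rule N[OF d n])
      also have "\<dots> \<le> cmod (g d)"
        using norm_quad_map_add_ge[of d "(quad_map d ^^ n) \<alpha>"] R[OF d] N[OF d n]
        by (simp add: g_def)
      finally show ?thesis .
    qed
    \<comment> \<open>Minimum modulus principle: without a zero, \<open>1 / g\<close> would violate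
      the maximum principle on the disc.\<close>
    then obtain d where "d \<in> ball c r" "g d = 0"
      using holomorphic_contract_to_zero
        [OF holomorphic_on_imp_continuous_on[OF hol] hol \<open>0 < r\<close>]
      by blast
    then show "\<exists>d\<in>ball c r. (quad_map d ^^ Suc n) \<alpha> = - (quad_map d ^^ n) \<alpha>"
      by (auto simp: g_def eq_neg_iff_add_eq_0)
  qed
qed

lemma quad_map_0_iterate_eq_0_iff: "(quad_map 0 ^^ n) \<alpha> = 0 \<longleftrightarrow> \<alpha> = 0"
  by (induction n) (auto simp: quad_map_def)

text \<open>The disc of radius 1/2 is mapped into itself, because 1/4 + 1/4 = 1/2.\<close>

lemma cball_subset_gen_mandelbrot_0: "cball 0 (1/4) \<subseteq> gen_mandelbrot 0"
proof
  fix c :: complex assume c: "c \<in> cball 0 (1/4)"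
  have "cmod ((quad_map c ^^ n) 0) \<le> 1/2" for n
  proof (induction n)
    case (Suc n)
    have "cmod (((quad_map c ^^ n) 0)\<^sup>2) \<le> (1/2)\<^sup>2"
      unfolding norm_power using Suc by (intro power_mono) auto
    then have "cmod (((quad_map c ^^ n) 0)\<^sup>2 + c) \<le> 1/2"
      using c norm_triangle_ineq[of "((quad_map c ^^ n) 0)\<^sup>2" c]
      by (simp add: power_divide)
    then show ?case
      by (simp add: quad_map_def[of c "(quad_map c ^^ n) 0"])
  qed simp
  then show "c \<in> gen_mandelbrot 0" unfolding mem_gen_mandelbrot_iff by blast
qed

theorem theorem1p3:
  fixes \<alpha> :: complex
  shows "\<not> (\<exists>c. c isolated_in gen_mandelbrot \<alpha>)"
proof
  assume "\<exists>c. c isolated_in gen_mandelbrot \<alpha>"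
  then obtain c e where c: "c \<in> gen_mandelbrot \<alpha>" and "0 < e"
    and iso: "\<And>d. d \<in> gen_mandelbrot \<alpha> \<Longrightarrow> dist c d < e \<Longrightarrow> d = c"
    unfolding isolated_in_dist_Ex_iff by blast
  \<comment> \<open>Points of this circle differ from \<open>c\<close> but lie within the isolating
    radius \<open>e\<close>.\<close>
  have "sphere c (e/2) \<inter> gen_mandelbrot \<alpha> = {}"
    using \<open>0 < e\<close> by (auto dest!: iso)
  then obtain N where N: "\<And>n. N \<le> n \<Longrightarrow>
      \<exists>d\<in>ball c (e/2). (quad_map d ^^ Suc n) \<alpha> = - (quad_map d ^^ n) \<alpha>"
    using quad_map_iterates_opposite_near[OF c, of "e/2"] \<open>0 < e\<close> by auto
  have opp: "(quad_map c ^^ Suc n) \<alpha> = - (quad_map c ^^ n) \<alpha>" if n: "N \<le> n" for n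
  proof -
    obtain d where d: "d \<in> ball c (e/2)" "(quad_map d ^^ Suc n) \<alpha> = - (quad_map d ^^ n) \<alpha>"
      using N[OF n] by blast
    \<comment> \<open>Squaring forgets the sign, so opposite points have the same image.\<close>
    then have "(quad_map d ^^ Suc (Suc n)) \<alpha> = (quad_map d ^^ Suc n) \<alpha>"
      by (simp add: quad_map_def)
    then have "d = c"
      using iso[OF mem_gen_mandelbrot_if_eventually_fixed[of "Suc n"]] d(1) \<open>0 < e\<close> by simp
    then show ?thesis using d(2) by simp
  qed
  have zero: "(quad_map c ^^ N) \<alpha> = 0"
  proof -
    \<comment> \<open>By \<open>opp\<close> at \<open>Suc N\<close> these two equal iterates are
      also opposite, hence both 0; \<open>opp\<close> at \<open>N\<close> then carries the zero back
      to time \<open>N\<close>.\<close>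
    have "(quad_map c ^^ Suc (Suc N)) \<alpha> = (quad_map c ^^ Suc N) \<alpha>"
      using opp[of N] by (simp add: quad_map_def)
    then show ?thesis using opp[of N] opp[of "Suc N"] by simp
  qed
  then have "c = 0" using opp[of N] by (simp add: quad_map_def)
  then have "\<alpha> = 0" using zero quad_map_0_iterate_eq_0_iff by simp
  \<comment> \<open>A nonzero parameter inside both the disc of radius 1/4 and the isolating disc
    around \<open>c = 0\<close>.\<close>
  define d where "d = complex_of_real (min (1/4) (e/2))"
  have "cmod d = min (1/4) (e/2)" using \<open>0 < e\<close> by (simp add: d_def)
  then have "d \<in> gen_mandelbrot \<alpha>" "dist c d < e" "d \<noteq> c"
    using cball_subset_gen_mandelbrot_0 \<open>0 < e\<close> \<open>c = 0\<close> \<open>\<alpha> = 0\<close> by (auto simp: min_def split: if_splits)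
  then show False using iso by blast
qed

end
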